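(* Every finite dimensional quiver representation of type $A_n$ over a field $\mathbb{F}$ (with arbitrary directions of the arrows) has a barcode form: its companion matrix $A$ admits a factorization $A=B\Lambda B^{-1}$ with $B$ a block-diagonal invertible matrix, with block sizes the dimensions of the vertex spaces, and $\Lambda$ a matrix in barcode form.
   Context: A quiver representation of type $A_n$ assigns to the vertices $1,\dots,n$ of a line graph with directed edges finite-dimensional $\mathbb F$-vector spaces $V_1,\dots,V_n$ (with chosen bases) and to each directed edge between consecutive vertices a linear map (matrix) in the direction of the arrow. Its companion matrix is the block matrix acting on $V=\bigoplus_iV_i$, sending vectors to their images under the edge maps: its non-zero blocks are the edge matrices, placed in the non-zero entries of the adjacency matrix of the directed graph. The interval representation $I[b,d]$ ($b\le d$) has $\mathbb F$ at the vertices $b,\dots,d$ and $0$ elsewhere, identity maps on edges between two copies of $\mathbb F$ and zero maps otherwise (all edges with the directions of the given quiver). A companion matrix $\Lambda$ is in barcode form if $\Lambda=PTP^T$ where $T$ is a direct sum of companion matrices of interval representations $I[b_i,d_i]$ and $P$ is a permutation matrix that regroups the basis vectors by vertex, so that $\Lambda$ has the block structure of $A$. *)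

theory Defs
  imports "Jordan_Normal_Form.Matrix" "HOL-Combinatorics.Permutations"
begin

text \<open>
  Vertices of \<open>A\<^sub>n\<close> are numbered \<open>0, \<dots>, n - 1\<close>, in line with the 0-based indices of
  \<open>'a mat\<close>. An orientation is given by \<open>fwd\<close>: the edge between \<open>i\<close> and \<open>Suc i\<close> points from
  \<open>i\<close> to \<open>Suc i\<close> if \<open>fwd i\<close> holds, and from \<open>Suc i\<close> to \<open>i\<close> otherwise.
\<close>

definition arrow :: "nat \<Rightarrow> (nat \<Rightarrow> bool) \<Rightarrow> nat \<Rightarrow> nat \<Rightarrow> bool" where
  "arrow n fwd i j \<longleftrightarrow>
     (j = Suc i \<and> j < n \<and> fwd i) \<or> (i = Suc j \<and> i < n \<and> \<not> fwd j)"

text \<open>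
  \<open>d i\<close> is the dimension of the space at vertex \<open>i\<close> and \<open>M i j\<close> the matrix, acting on column
  vectors, of the map along the arrow from \<open>i\<close> to \<open>j\<close>. Values of \<open>d\<close> outside \<open>{..<n}\<close> and of
  \<open>M\<close> off the arrows are irrelevant.
\<close>

definition quiver_rep ::
  "nat \<Rightarrow> (nat \<Rightarrow> bool) \<Rightarrow> (nat \<Rightarrow> nat) \<Rightarrow> (nat \<Rightarrow> nat \<Rightarrow> 'a mat) \<Rightarrow> bool" where
  "quiver_rep n fwd d M \<longleftrightarrow>
     (\<forall>i j. arrow n fwd i j \<longrightarrow> M i j \<in> carrier_mat (d j) (d i))"

definition total_dim :: "nat \<Rightarrow> (nat \<Rightarrow> nat) \<Rightarrow> nat" where
  "total_dim n d = (\<Sum>i<n. d i)"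

text \<open>
  The basis of the direct sum of the vertex spaces, in order: the pair \<open>(i, p)\<close> stands for the
  \<open>p\<close>-th basis vector of the space at vertex \<open>i\<close>.
\<close>

definition basis_list :: "nat \<Rightarrow> (nat \<Rightarrow> nat) \<Rightarrow> (nat \<times> nat) list" where
  "basis_list n d = concat (map (\<lambda>i. map (Pair i) [0..<d i]) [0..<n])"

lemma length_basis_list: "length (basis_list n d) = total_dim n d"
  by (induction n) (simp_all add: basis_list_def total_dim_def)

text \<open>
  As matrices act on column vectors, \<open>M i j\<close> occupies block row \<open>j\<close> and block column \<open>i\<close>.
\<close>

definition companion_mat ::
  "nat \<Rightarrow> (nat \<Rightarrow> bool) \<Rightarrow> (nat \<Rightarrow> nat) \<Rightarrow> (nat \<Rightarrow> nat \<Rightarrow> 'a :: zero mat) \<Rightarrow> 'a mat" where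
  "companion_mat n fwd d M =
     mat (total_dim n d) (total_dim n d)
       (\<lambda>(r, c). case (basis_list n d ! r, basis_list n d ! c) of
          ((j, p), (i, q)) \<Rightarrow> if arrow n fwd i j then M i j $$ (p, q) else 0)"

definition interval_dim :: "nat \<Rightarrow> nat \<Rightarrow> nat \<Rightarrow> nat" where
  "interval_dim b e i = (if b \<le> i \<and> i \<le> e then 1 else 0)"

definition interval_map :: "nat \<Rightarrow> nat \<Rightarrow> nat \<Rightarrow> nat \<Rightarrow> 'a :: {zero,one} mat" where
  "interval_map b e i j =
     (if i \<in> {b..e} \<and> j \<in> {b..e} then 1\<^sub>m 1
      else 0\<^sub>m (interval_dim b e j) (interval_dim b e i))"

lemma quiver_rep_interval: "quiver_rep n fwd (interval_dim b e) (interval_map b e)"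
  by (auto simp: quiver_rep_def interval_map_def interval_dim_def)

definition barcode_sum ::
  "nat \<Rightarrow> (nat \<Rightarrow> bool) \<Rightarrow> (nat \<times> nat) list \<Rightarrow> 'a :: {zero,one} mat" where
  "barcode_sum n fwd bars =
     diag_block_mat
       (map (\<lambda>(b, e). companion_mat n fwd (interval_dim b e) (interval_map b e)) bars)"

text \<open>The vertices at which the successive basis vectors of the direct sum of intervals live.\<close>

definition barcode_vertices :: "nat \<Rightarrow> (nat \<times> nat) list \<Rightarrow> nat list" where
  "barcode_vertices n bars =
     concat (map (\<lambda>(b, e). map fst (basis_list n (interval_dim b e))) bars)"

definition perm_mat :: "nat \<Rightarrow> (nat \<Rightarrow> nat) \<Rightarrow> 'a :: {zero,one} mat" where
  "perm_mat N \<pi> = mat N N (\<lambda>(r, c). if r = \<pi> c then 1 else 0)"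

text \<open>
  The permutation \<open>\<pi>\<close> regroups the basis by vertex: a basis vector of the direct sum of
  intervals that lives at vertex \<open>i\<close> is sent to a position in the block of vertex \<open>i\<close>.
  The length condition makes the matrix products well-dimensioned.
\<close>

definition barcode_form ::
  "nat \<Rightarrow> (nat \<Rightarrow> bool) \<Rightarrow> (nat \<Rightarrow> nat) \<Rightarrow> 'a :: semiring_1 mat \<Rightarrow> bool" where
  "barcode_form n fwd d \<Lambda> \<longleftrightarrow>
     (\<exists>bars \<pi>.
        (\<forall>(b, e) \<in> set bars. b \<le> e \<and> e < n) \<and>
        length (barcode_vertices n bars) = total_dim n d \<and>
        \<pi> permutes {..<total_dim n d} \<and>
        (\<forall>c < total_dim n d. fst (basis_list n d ! \<pi> c) = barcode_vertices n bars ! c) \<and>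
        \<Lambda> = perm_mat (total_dim n d) \<pi> * barcode_sum n fwd bars
              * (perm_mat (total_dim n d) \<pi>)\<^sup>T) \<and>
     (\<exists>M. quiver_rep n fwd d M \<and> \<Lambda> = companion_mat n fwd d M)"

end

theory Submission
  imports Defs "Jordan_Normal_Form.Determinant"
begin

text \<open>
  The idea is to choose bases of the vertex spaces, from left to right along the line, in which
  every arrow becomes a partial permutation matrix: each basis vector is sent to a basis vector
  or to zero, and no basis vector is hit twice. Such a representation is visibly a direct sum of
  intervals, as the basis vectors fall into chains that run through consecutive vertices.

  The difficulty is that normalising the next arrow needs changes of the basis at
  the last vertex, which must not destroy the arrows to its left. At each vertex there
  is a flag of subspaces intrinsic to the part of the representation to the left, such that every
  base change respecting the flag can be propagated leftwards. Concretely,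
  \<open>reduces_flexible\<close> provides an ordered basis at the last vertex all of whose unitriangular
  modifications extend to bases with partial permutation matrices everywhere. Adding a vertex
  requires an ordered basis of the new space that is adapted to the images of the flag for an
  outgoing arrow (\<open>reduce_forward_arrow\<close>), or to its preimages for an incoming one
  (\<open>reduce_backward_arrow\<close>). Both come from Gauss-Jordan elimination, whose pivots record
  where the map meets the steps of the flag.

  The passage to matrices is bookkeeping. All matrices are viewed as functions of pairs of basis
  vectors, arranged along a list of them. In this view the simultaneous base change is the
  block-diagonal similarity (\<open>reduces_similar\<close>), and listing the basis vectors chain by
  chain, instead of vertex by vertex, turns the companion matrix into a direct sum of interval
  blocks (\<open>barcode_form_companion_mat\<close>).
\<close>

section \<open>Unitriangular matrices and partial permutation matrices\<close>

definition unitriangular :: "nat \<Rightarrow> 'a :: comm_ring_1 mat \<Rightarrow> bool" where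
  "unitriangular n U \<longleftrightarrow> U \<in> carrier_mat n n \<and> upper_triangular U \<and> (\<forall>i<n. U $$ (i, i) = 1)"

lemma unitriangular_carrier: "unitriangular n U \<Longrightarrow> U \<in> carrier_mat n n"
  by (simp add: unitriangular_def)

lemma unitriangular_one: "unitriangular n (1\<^sub>m n)"
  by (simp add: unitriangular_def)

lemma det_unitriangular:
  assumes "unitriangular n U"
  shows "det U = 1"
proof -
  have "det U = prod_list (diag_mat U)"
    using assms by (intro det_upper_triangular) (auto simp: unitriangular_def)
  also have "\<dots> = (\<Prod>i = 0..<n. U $$ (i, i))"
    using assms by (auto simp: prod_list_diag_prod unitriangular_def)
  also have "\<dots> = 1"
    using assms by (simp add: unitriangular_def)
  finally show ?thesis .
qed

lemma det_nonzero_obtain_inverse: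
  fixes A :: "'a :: field mat"
  assumes "A \<in> carrier_mat n n" "det A \<noteq> 0"
  obtains B where "B \<in> carrier_mat n n" "A * B = 1\<^sub>m n" "B * A = 1\<^sub>m n"
  using det_non_zero_imp_unit[OF assms, of undefined] that
  by (auto simp: Units_def ring_mat_simps)

definition partial_perm :: "'a :: zero_neq_one mat \<Rightarrow> bool" where
  "partial_perm P \<longleftrightarrow>
     (\<forall>r<dim_row P. \<forall>c<dim_col P. P $$ (r, c) \<in> {0, 1}) \<and>
     (\<forall>r<dim_row P. \<forall>c<dim_col P. \<forall>c'<dim_col P.
        P $$ (r, c) \<noteq> 0 \<longrightarrow> P $$ (r, c') \<noteq> 0 \<longrightarrow> c = c') \<and>
     (\<forall>r<dim_row P. \<forall>r'<dim_row P. \<forall>c<dim_col P.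
        P $$ (r, c) \<noteq> 0 \<longrightarrow> P $$ (r', c) \<noteq> 0 \<longrightarrow> r = r')"

section \<open>Reduction along a single arrow\<close>

text \<open>
  Let \<open>X\<close> be the matrix of a map out of the current vertex, whose basis may be changed by
  unitriangular matrices \<open>U\<close> only; the flag spanned by its first basis vectors is thereby fixed.
  The basis \<open>D\<close> of the target starts with the successive new directions in the images of
  that flag, and continues arbitrarily. These directions are what row reduction \<open>X = D * R\<close>
  finds, since pivot columns move to the right as one goes down the rows. A unitriangular
  change \<open>V\<close> in the target alters the pivot vectors by earlier pivot vectors only, so it lifts
  to the source, and the columns of \<open>R\<close> without pivot are cleared by those to their left.
\<close>

lemma reduce_forward_arrow:
  fixes X :: "'a :: field mat"
  assumes X: "X \<in> carrier_mat m n"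
  shows "\<exists>D \<in> carrier_mat m m. det D \<noteq> 0 \<and>
           (\<forall>V. unitriangular m V \<longrightarrow>
              (\<exists>U P. unitriangular n U \<and> P \<in> carrier_mat m n \<and> partial_perm P \<and>
                 X * U = D * V * P))"
proof -
  define R where "R = gauss_jordan_single X"
  have R: "R \<in> carrier_mat m n" and ech: "row_echelon_form R"
    using gauss_jordan_single[OF X R_def[symmetric]] by auto
  obtain Q D where QD: "R = Q * X" "Q \<in> carrier_mat m m" "D \<in> carrier_mat m m" "D * Q = 1\<^sub>m m"
    using gauss_jordan_single(4)[OF X R_def[symmetric]] by auto
  have XR: "X = D * R"
    using QD X by (simp add: assoc_mult_mat[symmetric])
  have "det D * det Q = 1"
    using QD by (metis det_mult det_one)
  hence detD: "det D \<noteq> 0" by auto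
  obtain f where pf: "pivot_fun R f n"
    using ech R by (auto simp: row_echelon_form_def)
  have dR: "dim_row R = m" using R by simp
  note piv = pivot_funD[OF dR pf]
  have mono: "f s = n \<or> f r < f s" if "r < s" "s < m" for r s
    using pivot_bound[OF dR pf, of r "s - r"] that by auto
  have inj: "r = s" if "f r = f s" "f r < n" "r < m" "s < m" for r s
    using mono[of r s] mono[of s r] that by (cases r s rule: linorder_cases) auto
  define g where "g c = (THE r. r < m \<and> f r = c)" for c
  have g: "g (f r) = r" if "r < m" "f r < n" for r
    unfolding g_def using inj that by (intro the_equality) auto
  \<comment> \<open>The pivot columns of \<open>R\<close> are unit vectors, so \<open>R\<close> reads off the coefficients of a
      combination of the pivot basis vectors.\<close>
  have key: "(\<Sum>a<n. R $$ (r, a) * (\<Sum>s<m. if f s = a then w s else 0)) =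
               (if f r < n then w r else 0)" if r: "r < m" for r and w :: "nat \<Rightarrow> 'a"
  proof -
    have "(\<Sum>a<n. R $$ (r, a) * (\<Sum>s<m. if f s = a then w s else 0)) =
          (\<Sum>a<n. \<Sum>s<m. if f s = a then R $$ (r, a) * w s else 0)"
      by (simp add: sum_distrib_left if_distrib cong: if_cong)
    also have "\<dots> = (\<Sum>s<m. \<Sum>a<n. if f s = a then R $$ (r, a) * w s else 0)"
      by (rule sum.swap)
    also have "\<dots> = (\<Sum>s<m. if s = r then (if f r < n then w r else 0) else 0)"
    proof (rule sum.cong)
      fix s assume "s \<in> {..<m}"
      thus "(\<Sum>a<n. if f s = a then R $$ (r, a) * w s else 0) =
            (if s = r then (if f r < n then w r else 0) else 0)"
        using piv(4)[of s] piv(5)[of s r] r by (auto simp: sum.delta')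
    qed simp
    also have "\<dots> = (if f r < n then w r else 0)"
      using r by simp
    finally show ?thesis .
  qed
  have "\<exists>U P. unitriangular n U \<and> P \<in> carrier_mat m n \<and> partial_perm P \<and> X * U = D * V * P"
    if V: "unitriangular m V" for V
  proof -
    define P :: "'a mat" where "P = mat m n (\<lambda>(r, c). if f r = c then 1 else 0)"
    \<comment> \<open>Column \<open>f t\<close> of \<open>U\<close> lifts column \<open>t\<close> of \<open>V\<close> to the pivot basis vectors; a column without
        pivot subtracts its expansion in pivot columns and so lies in the kernel of \<open>R\<close>.\<close>
    define U where "U = mat n n (\<lambda>(a, c).
        if c \<in> f ` {..<m} then \<Sum>s<m. if f s = a then V $$ (s, g c) else 0
        else (if a = c then 1 else 0) - (\<Sum>s<m. if f s = a then R $$ (s, c) else 0))"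
    have Vc: "V \<in> carrier_mat m m" using V by (simp add: unitriangular_def)
    have Vlow: "V $$ (a, b) = 0" if "b < a" "a < m" for a b
      using V that by (auto simp: unitriangular_def upper_triangular_def)
    have Vdiag: "V $$ (a, a) = 1" if "a < m" for a
      using V that by (auto simp: unitriangular_def)
    have P: "P \<in> carrier_mat m n" by (simp add: P_def)
    have Uc: "U \<in> carrier_mat n n" by (simp add: U_def)
    have pp: "partial_perm P"
      unfolding partial_perm_def P_def using inj by (auto split: if_splits)
    have Uut: "U $$ (a, c) = 0" if ac: "c < a" "a < n" for a c
    proof (cases "c \<in> f ` {..<m}")
      case True
      then obtain r where r: "r < m" "c = f r" by auto
      have "V $$ (s, r) = 0" if "s < m" "f s = a" for s
        using mono[of s r] Vlow[of r s] ac r that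
        by (cases s r rule: linorder_cases) auto
      thus ?thesis using ac r g[of r] by (auto simp: U_def intro!: sum.neutral)
    next
      case False
      have "R $$ (s, c) = 0" if "s < m" "f s = a" for s
        using piv(2)[of s c] ac that by auto
      thus ?thesis using ac False by (auto simp: U_def intro!: sum.neutral)
    qed
    have Udiag: "U $$ (c, c) = 1" if c: "c < n" for c
    proof (cases "c \<in> f ` {..<m}")
      case True
      then obtain r where r: "r < m" "c = f r" by auto
      have "(\<Sum>s<m. if f s = c then V $$ (s, g c) else 0) = (\<Sum>s<m. if s = r then V $$ (s, r) else 0)"
        using r c inj g by (intro sum.cong) auto
      thus ?thesis using r c Vdiag by (auto simp: U_def)
    next
      case False
      thus ?thesis using c by (auto simp: U_def intro!: sum.neutral)
    qed
    have uni: "unitriangular n U"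
      using Uc Uut Udiag by (auto simp: unitriangular_def)
    have RU: "R * U = V * P"
    proof (rule eq_matI)
      fix r c assume "r < dim_row (V * P)" "c < dim_col (V * P)"
      hence r: "r < m" and c: "c < n" using Vc P by auto
      have lhs: "(R * U) $$ (r, c) = (\<Sum>a<n. R $$ (r, a) * U $$ (a, c))"
        using r c R Uc by (auto simp: scalar_prod_def atLeast0LessThan)
      have rhs: "(V * P) $$ (r, c) = (\<Sum>s<m. if f s = c then V $$ (r, s) else 0)"
        using r c Vc by (auto simp: scalar_prod_def atLeast0LessThan P_def intro!: sum.cong)
      show "(R * U) $$ (r, c) = (V * P) $$ (r, c)"
      proof (cases "c \<in> f ` {..<m}")
        case True
        then obtain t where t: "t < m" "c = f t" by auto
        have "(R * U) $$ (r, c) =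
              (\<Sum>a<n. R $$ (r, a) * (\<Sum>s<m. if f s = a then V $$ (s, t) else 0))"
          unfolding lhs using t c g[OF t(1)] by (intro sum.cong) (simp_all add: U_def cong: if_cong)
        also have "\<dots> = (if f r < n then V $$ (r, t) else 0)"
          by (rule key[OF r])
        also have "\<dots> = V $$ (r, t)"
          using mono[of t r] mono[of r t] Vlow[of t r] piv(1)[of r] r t c
          by (cases t r rule: linorder_cases) auto
        also have "\<dots> = (\<Sum>s<m. if s = t then V $$ (r, s) else 0)"
          using t by simp
        also have "\<dots> = (V * P) $$ (r, c)"
          unfolding rhs using t c inj by (intro sum.cong) auto
        finally show ?thesis .
      next
        case False
        have "(R * U) $$ (r, c) =
              (\<Sum>a<n. if a = c then R $$ (r, a) else 0) -
              (\<Sum>a<n. R $$ (r, a) * (\<Sum>s<m. if f s = a then R $$ (s, c) else 0))"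
          unfolding lhs sum_subtractf[symmetric] using False c
          by (intro sum.cong) (auto simp: U_def algebra_simps)
        also have "\<dots> = R $$ (r, c) - (if f r < n then R $$ (r, c) else 0)"
          using c by (simp add: key[OF r])
        also have "\<dots> = 0"
          using piv(1)[of r] piv(2)[of r c] r c by auto
        also have "\<dots> = (V * P) $$ (r, c)"
          unfolding rhs using False by (auto intro!: sum.neutral)
        finally show ?thesis .
      qed
    qed (use R Uc Vc P in auto)
    have "X * U = D * (V * P)"
      unfolding XR RU[symmetric] using QD R Uc by (intro assoc_mult_mat) auto
    also have "\<dots> = D * V * P"
      using QD Vc P by (intro assoc_mult_mat[symmetric]) auto
    finally show ?thesis using uni P pp by blast
  qed
  thus ?thesis using QD(3) detD by blast
qed

text \<open>
  The mirror image of row reduction: rows and columns of the transpose of \<open>X\<close> are reversed.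
  The reversal makes the columns of the kernel come first. The number \<open>h c\<close> is one more than
  the index of the lowest non-zero entry in column \<open>c\<close>, and \<open>0\<close> for a zero column.
\<close>

lemma column_echelon:
  fixes X :: "'a :: field mat"
  assumes X: "X \<in> carrier_mat m n"
  obtains D h where "D \<in> carrier_mat n n" "det D \<noteq> 0"
    "\<And>r c. c < n \<Longrightarrow> r < m \<Longrightarrow> h c \<le> r \<Longrightarrow> (X * D) $$ (r, c) = 0"
    "\<And>c. c < n \<Longrightarrow> h c \<le> m"
    "\<And>c. c < n \<Longrightarrow> h c > 0 \<Longrightarrow> (X * D) $$ (h c - 1, c) = 1"
    "\<And>c c'. c < c' \<Longrightarrow> c' < n \<Longrightarrow> h c = 0 \<or> h c < h c'"
proof -
  define Y where "Y = mat n m (\<lambda>(i, j). X $$ (m - 1 - j, i))"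
  have Y: "Y \<in> carrier_mat n m" by (simp add: Y_def)
  define E where "E = gauss_jordan_single Y"
  have E: "E \<in> carrier_mat n m" and ech: "row_echelon_form E"
    using gauss_jordan_single[OF Y E_def[symmetric]] by auto
  obtain Q Q' where Q: "E = Q * Y" "Q \<in> carrier_mat n n" "Q' \<in> carrier_mat n n"
      "Q * Q' = 1\<^sub>m n"
    using gauss_jordan_single(4)[OF Y E_def[symmetric]] by auto
  obtain f where pf: "pivot_fun E f m"
    using ech E by (auto simp: row_echelon_form_def)
  have dE: "dim_row E = n" using E by simp
  note piv = pivot_funD[OF dE pf]
  define D where "D = mat n n (\<lambda>(a, c). Q $$ (n - 1 - c, a))"
  define D' where "D' = mat n n (\<lambda>(a, c). Q' $$ (c, n - 1 - a))"
  have D: "D \<in> carrier_mat n n" "D' \<in> carrier_mat n n" by (simp_all add: D_def D'_def)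
  have "D' * D = 1\<^sub>m n"
  proof (rule eq_matI)
    fix r c assume rc: "r < dim_row (1\<^sub>m n)" "c < dim_col (1\<^sub>m n)"
    show "(D' * D) $$ (r, c) = (1\<^sub>m n) $$ (r, c)"
    proof -
      have "(D' * D) $$ (r, c) = (\<Sum>a<n. Q $$ (n - 1 - c, a) * Q' $$ (a, n - 1 - r))"
        using rc D by (auto simp: D_def D'_def scalar_prod_def atLeast0LessThan mult.commute intro!: sum.cong)
      also have "\<dots> = (Q * Q') $$ (n - 1 - c, n - 1 - r)"
        using rc Q(2,3) by (auto simp: scalar_prod_def atLeast0LessThan)
      also have "\<dots> = (1\<^sub>m n) $$ (r, c)"
        using rc Q(4) by auto
      finally show ?thesis .
    qed
  qed (use D in auto)
  hence "det D' * det D = 1"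
    using D by (metis det_mult det_one)
  hence detD: "det D \<noteq> 0" by auto
  have XD: "(X * D) $$ (r, c) = E $$ (n - 1 - c, m - 1 - r)" if "r < m" "c < n" for r c
    using that X Q Y
    by (auto simp: D_def Y_def scalar_prod_def atLeast0LessThan mult.commute intro!: sum.cong)
  define h where "h c = m - f (n - 1 - c)" for c
  show ?thesis
  proof (rule that[of D h])
    fix r c assume "c < n" "r < m" "h c \<le> r"
    thus "(X * D) $$ (r, c) = 0"
      using XD[of r c] piv(2)[of "n - 1 - c" "m - 1 - r"] by (auto simp: h_def)
  next
    fix c assume c: "c < n" "h c > 0"
    have "m - 1 - (h c - 1) = f (n - 1 - c)" "f (n - 1 - c) < m"
      using c piv(1)[of "n - 1 - c"] by (auto simp: h_def)
    thus "(X * D) $$ (h c - 1, c) = 1"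
      using XD[of "h c - 1" c] piv(4)[of "n - 1 - c"] c by (auto simp: h_def)
  next
    fix c c' assume "c < c'" "c' < n"
    thus "h c = 0 \<or> h c < h c'"
      using pivot_bound[OF dE pf, of "n - 1 - c'" "c' - c"] piv(1)[of "n - 1 - c"]
      by (auto simp: h_def)
  qed (use D detD in \<open>auto simp: h_def\<close>)
qed

text \<open>
  Here \<open>X\<close> is the matrix of a map into the current vertex. The new basis \<open>D\<close> has to be adapted
  to the preimages of the flag spanned by the first basis vectors of the target: first the
  kernel, then vectors whose images reach further and further into that flag. A unitriangular
  combination \<open>V\<close> of them keeps the lowest entry of each image, so these images
  can replace the target basis vectors at the pivots by a unitriangular change \<open>U\<close>.
\<close>

lemma reduce_backward_arrow:
  fixes X :: "'a :: field mat"
  assumes X: "X \<in> carrier_mat m n"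
  shows "\<exists>D \<in> carrier_mat n n. det D \<noteq> 0 \<and>
           (\<forall>V. unitriangular n V \<longrightarrow>
              (\<exists>U P. unitriangular m U \<and> P \<in> carrier_mat m n \<and> partial_perm P \<and>
                 X * (D * V) = U * P))"
proof -
  from column_echelon[OF X] obtain D h where D: "D \<in> carrier_mat n n" and detD: "det D \<noteq> 0"
    and zero: "\<And>r c. c < n \<Longrightarrow> r < m \<Longrightarrow> h c \<le> r \<Longrightarrow> (X * D) $$ (r, c) = 0"
    and bound: "\<And>c. c < n \<Longrightarrow> h c \<le> m"
    and one: "\<And>c. c < n \<Longrightarrow> h c > 0 \<Longrightarrow> (X * D) $$ (h c - 1, c) = 1"
    and mono: "\<And>c c'. c < c' \<Longrightarrow> c' < n \<Longrightarrow> h c = 0 \<or> h c < h c'"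
    by blast
  define R where "R = X * D"
  have R: "R \<in> carrier_mat m n" using X D by (simp add: R_def)
  note zero = zero[folded R_def] and one = one[folded R_def]
  have inj: "c = c'" if "h c = h c'" "h c > 0" "c < n" "c' < n" for c c'
    using mono[of c c'] mono[of c' c] that by (cases c c' rule: linorder_cases) auto
  have "\<exists>U P. unitriangular m U \<and> P \<in> carrier_mat m n \<and> partial_perm P \<and> X * (D * V) = U * P"
    if V: "unitriangular n V" for V
  proof -
    define g where "g b = (THE c. c < n \<and> h c = Suc b)" for b
    have g: "g b = c" if "c < n" "h c = Suc b" for b c
      unfolding g_def using inj that by (intro the_equality) auto
    have Vc: "V \<in> carrier_mat n n" using V by (simp add: unitriangular_def)
    have Vlow: "V $$ (a, b) = 0" if "b < a" "a < n" for a b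
      using V that by (auto simp: unitriangular_def upper_triangular_def)
    have Vdiag: "V $$ (a, a) = 1" if "a < n" for a
      using V that by (auto simp: unitriangular_def)
    have RV: "(R * V) $$ (a, c) = (\<Sum>x<n. R $$ (a, x) * V $$ (x, c))" if "a < m" "c < n" for a c
      using that R Vc by (auto simp: scalar_prod_def atLeast0LessThan)
    \<comment> \<open>A unitriangular column combination adds only columns whose lowest entries lie higher up.\<close>
    have RV0: "(R * V) $$ (a, c) = 0" if ac: "a < m" "c < n" "h c \<le> a" for a c
    proof -
      have "R $$ (a, x) * V $$ (x, c) = 0" if x: "x < n" for x
        using Vlow[of c x] zero[of x a] mono[of x c] ac x
        by (cases x c rule: linorder_cases) auto
      thus ?thesis unfolding RV[OF ac(1,2)] by (intro sum.neutral) auto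
    qed
    have RV1: "(R * V) $$ (a, c) = 1" if ac: "a < m" "c < n" "h c = Suc a" for a c
    proof -
      have "R $$ (a, x) * V $$ (x, c) = (if x = c then 1 else 0)" if x: "x < n" for x
        using Vlow[of c x] zero[of x a] mono[of x c] one[of c] Vdiag[of c] ac x
        by (cases x c rule: linorder_cases) auto
      hence "(R * V) $$ (a, c) = (\<Sum>x<n. if x = c then 1 else 0)"
        unfolding RV[OF ac(1,2)] by (intro sum.cong) auto
      thus ?thesis using ac by simp
    qed
    define P :: "'a mat" where "P = mat m n (\<lambda>(r, c). if h c = Suc r then 1 else 0)"
    \<comment> \<open>At a pivot row \<open>b\<close>, the basis vector is replaced by the image that has its lowest
        entry there.\<close>
    define U where "U = mat m m (\<lambda>(a, b).
        if Suc b \<in> h ` {..<n} then (R * V) $$ (a, g b) else if a = b then 1 else 0)"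
    have P: "P \<in> carrier_mat m n" by (simp add: P_def)
    have Uc: "U \<in> carrier_mat m m" by (simp add: U_def)
    have pp: "partial_perm P"
      unfolding partial_perm_def P_def using inj by (auto split: if_splits)
    have uni: "unitriangular m U"
      unfolding unitriangular_def upper_triangular_def
      using g RV0 RV1 by (auto simp: U_def)
    have eq: "R * V = U * P"
    proof (rule eq_matI)
      fix a c assume "a < dim_row (U * P)" "c < dim_col (U * P)"
      hence a: "a < m" and c: "c < n" using Uc P by auto
      have UP: "(U * P) $$ (a, c) = (\<Sum>b<m. if h c = Suc b then U $$ (a, b) else 0)"
        using a c Uc by (auto simp: scalar_prod_def atLeast0LessThan P_def intro!: sum.cong)
      show "(R * V) $$ (a, c) = (U * P) $$ (a, c)"
      proof (cases "h c")
        case 0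
        thus ?thesis using RV0[OF a c] UP by simp
      next
        case (Suc b)
        hence b: "b < m" using bound[OF c] by simp
        have "Suc b \<in> h ` {..<n}" using Suc c by (metis imageI lessThan_iff)
        hence "U $$ (a, b) = (R * V) $$ (a, c)"
          using a b g[OF c Suc] by (simp add: U_def)
        thus ?thesis unfolding UP using Suc b by simp
      qed
    qed (use R Uc Vc P in auto)
    have "X * (D * V) = U * P"
      unfolding eq[symmetric] R_def using X D Vc by (intro assoc_mult_mat[symmetric]) auto
    thus ?thesis using uni P pp by blast
  qed
  thus ?thesis using D detD by blast
qed

section \<open>Simultaneous reduction along the line\<close>

text \<open>
  A choice of bases \<open>C i\<close> of all vertex spaces in which the representation \<open>M\<close> becomes \<open>N\<close>,
  all of whose arrows send basis vectors to distinct basis vectors or to zero.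
\<close>

definition reduces ::
  "nat \<Rightarrow> (nat \<Rightarrow> bool) \<Rightarrow> (nat \<Rightarrow> nat) \<Rightarrow> (nat \<Rightarrow> nat \<Rightarrow> 'a :: field mat) \<Rightarrow>
     (nat \<Rightarrow> 'a mat) \<Rightarrow> (nat \<Rightarrow> nat \<Rightarrow> 'a mat) \<Rightarrow> bool" where
  "reduces n fwd d M C N \<longleftrightarrow>
     (\<forall>i<n. C i \<in> carrier_mat (d i) (d i) \<and> det (C i) \<noteq> 0) \<and>
     (\<forall>i j. arrow n fwd i j \<longrightarrow>
        N i j \<in> carrier_mat (d j) (d i) \<and> partial_perm (N i j) \<and> M i j * C i = C j * N i j)"

lemma reducesD:
  assumes "reduces n fwd d M C N"
  shows "i < n \<Longrightarrow> C i \<in> carrier_mat (d i) (d i)" "i < n \<Longrightarrow> det (C i) \<noteq> 0"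
    "arrow n fwd i j \<Longrightarrow> N i j \<in> carrier_mat (d j) (d i)"
    "arrow n fwd i j \<Longrightarrow> partial_perm (N i j)"
    "arrow n fwd i j \<Longrightarrow> M i j * C i = C j * N i j"
  using assms by (auto simp: reduces_def)

lemma arrow_Suc_Suc:
  "arrow (Suc (Suc k)) fwd i j \<longleftrightarrow>
     arrow (Suc k) fwd i j \<or> i = k \<and> j = Suc k \<and> fwd k \<or> i = Suc k \<and> j = k \<and> \<not> fwd k"
  by (auto simp: arrow_def less_Suc_eq)

lemma reduces_extend:
  assumes S: "reduces (Suc k) fwd d M C N"
    and D: "D \<in> carrier_mat (d (Suc k)) (d (Suc k))" "det D \<noteq> 0"
    and P: "partial_perm P"
    and fwd: "fwd k \<Longrightarrow> P \<in> carrier_mat (d (Suc k)) (d k) \<and> M k (Suc k) * C k = D * P"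
    and bwd: "\<not> fwd k \<Longrightarrow> P \<in> carrier_mat (d k) (d (Suc k)) \<and> M (Suc k) k * D = C k * P"
  shows "reduces (Suc (Suc k)) fwd d M (C(Suc k := D))
           (\<lambda>i j. if i = Suc k \<or> j = Suc k then P else N i j)"
proof -
  have old: "i \<noteq> Suc k \<and> j \<noteq> Suc k" if "arrow (Suc k) fwd i j" for i j
    using that by (auto simp: arrow_def)
  let ?C = "C(Suc k := D)" and ?N = "\<lambda>i j. if i = Suc k \<or> j = Suc k then P else N i j"
  have "?N i j \<in> carrier_mat (d j) (d i) \<and> partial_perm (?N i j) \<and> M i j * ?C i = ?C j * ?N i j"
    if "arrow (Suc (Suc k)) fwd i j" for i j
    using that unfolding arrow_Suc_Suc
  proof (elim disjE)
    assume ij: "arrow (Suc k) fwd i j"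
    thus ?thesis using old[OF ij] reducesD(3-5)[OF S ij] by simp
  qed (use P fwd bwd in auto)
  thus ?thesis
    using reducesD(1,2)[OF S] D by (auto simp: reduces_def less_Suc_eq)
qed

text \<open>
  Reducing one arrow after the other would spoil the arrows reduced before, unless the bases
  already chosen can follow any change that the next arrow demands. The induction therefore
  carries a freedom along: at the last vertex there is an ordered basis \<open>D\<close> each of whose
  unitriangular changes extends to a reduction of the whole representation. In terms of
  intervals, those alive at the last vertex are totally ordered by the
  existence of a homomorphism that is non-zero there, and \<open>D\<close> lists them in this order.
\<close>

lemma reduces_flexible:
  fixes M :: "nat \<Rightarrow> nat \<Rightarrow> 'a :: field mat"
  assumes "quiver_rep (Suc k) fwd d M"
  shows "\<exists>D \<in> carrier_mat (d k) (d k). det D \<noteq> 0 \<and>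
           (\<forall>V. unitriangular (d k) V \<longrightarrow>
              (\<exists>C N. reduces (Suc k) fwd d M C N \<and> C k = D * V))"
  using assms
proof (induction k)
  case 0
  have "reduces (Suc 0) fwd d M (\<lambda>_. V) N \<and> V = 1\<^sub>m (d 0) * V"
    if "unitriangular (d 0) V" for V :: "'a mat" and N
    using unitriangular_carrier[OF that] det_unitriangular[OF that]
    by (auto simp: reduces_def arrow_def)
  thus ?case
    by (intro bexI[of _ "1\<^sub>m (d 0)"]) fastforce+
next
  case (Suc k)
  have "quiver_rep (Suc k) fwd d M"
    using Suc.prems by (auto simp: quiver_rep_def arrow_Suc_Suc)
  then obtain E where E: "E \<in> carrier_mat (d k) (d k)" "det E \<noteq> 0"
    and IH: "\<And>U. unitriangular (d k) U \<Longrightarrow> \<exists>C N. reduces (Suc k) fwd d M C N \<and> C k = E * U"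
    using Suc.IH by blast
  show ?case
  proof (cases "fwd k")
    case True
    hence Mk: "M k (Suc k) \<in> carrier_mat (d (Suc k)) (d k)"
      using Suc.prems by (auto simp: quiver_rep_def arrow_Suc_Suc)
    with E have "M k (Suc k) * E \<in> carrier_mat (d (Suc k)) (d k)" by auto
    from reduce_forward_arrow[OF this] obtain D
      where D: "D \<in> carrier_mat (d (Suc k)) (d (Suc k))" "det D \<noteq> 0"
      and DU: "\<And>V. unitriangular (d (Suc k)) V \<Longrightarrow> \<exists>U P. unitriangular (d k) U \<and>
            P \<in> carrier_mat (d (Suc k)) (d k) \<and> partial_perm P \<and> M k (Suc k) * E * U = D * V * P"
      by blast
    have "\<exists>C N. reduces (Suc (Suc k)) fwd d M C N \<and> C (Suc k) = D * V"
      if V: "unitriangular (d (Suc k)) V" for V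
    proof -
      from DU[OF V] obtain U P where U: "unitriangular (d k) U"
        and P: "P \<in> carrier_mat (d (Suc k)) (d k)" "partial_perm P"
        and eq: "M k (Suc k) * E * U = D * V * P" by blast
      from IH[OF U] obtain C N where CN: "reduces (Suc k) fwd d M C N" "C k = E * U" by blast
      have "M k (Suc k) * C k = D * V * P"
        unfolding CN eq[symmetric]
        using Mk E unitriangular_carrier[OF U] by (intro assoc_mult_mat[symmetric]) auto
      moreover have "D * V \<in> carrier_mat (d (Suc k)) (d (Suc k))" "det (D * V) \<noteq> 0"
        using D unitriangular_carrier[OF V] det_unitriangular[OF V]
        by (auto simp: det_mult[of _ "d (Suc k)"])
      ultimately have "reduces (Suc (Suc k)) fwd d M (C(Suc k := D * V))
           (\<lambda>i j. if i = Suc k \<or> j = Suc k then P else N i j)"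
        using True P by (intro reduces_extend[OF CN(1)]) auto
      moreover have "(C(Suc k := D * V)) (Suc k) = D * V" by simp
      ultimately show ?thesis by blast
    qed
    thus ?thesis using D by blast
  next
    case False
    hence Mk: "M (Suc k) k \<in> carrier_mat (d k) (d (Suc k))"
      using Suc.prems by (auto simp: quiver_rep_def arrow_Suc_Suc)
    obtain E' where E': "E' \<in> carrier_mat (d k) (d k)" "E * E' = 1\<^sub>m (d k)"
      using det_nonzero_obtain_inverse[OF E] by metis
    define X where "X = E' * M (Suc k) k"
    have X: "X \<in> carrier_mat (d k) (d (Suc k))" using E' Mk by (auto simp: X_def)
    have EX: "E * X = M (Suc k) k"
      using E E' Mk by (simp add: X_def assoc_mult_mat[symmetric])
    from reduce_backward_arrow[OF X] obtain D
      where D: "D \<in> carrier_mat (d (Suc k)) (d (Suc k))" "det D \<noteq> 0"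
      and DU: "\<And>V. unitriangular (d (Suc k)) V \<Longrightarrow> \<exists>U P. unitriangular (d k) U \<and>
            P \<in> carrier_mat (d k) (d (Suc k)) \<and> partial_perm P \<and> X * (D * V) = U * P"
      by blast
    have "\<exists>C N. reduces (Suc (Suc k)) fwd d M C N \<and> C (Suc k) = D * V"
      if V: "unitriangular (d (Suc k)) V" for V
    proof -
      from DU[OF V] obtain U P where U: "unitriangular (d k) U"
        and P: "P \<in> carrier_mat (d k) (d (Suc k))" "partial_perm P"
        and eq: "X * (D * V) = U * P" by blast
      from IH[OF U] obtain C N where CN: "reduces (Suc k) fwd d M C N" "C k = E * U" by blast
      have DV: "D * V \<in> carrier_mat (d (Suc k)) (d (Suc k))" "det (D * V) \<noteq> 0"
        using D unitriangular_carrier[OF V] det_unitriangular[OF V]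
        by (auto simp: det_mult[of _ "d (Suc k)"])
      have "M (Suc k) k * (D * V) = E * (X * (D * V))"
        unfolding EX[symmetric] using E X DV by (intro assoc_mult_mat) auto
      also have "\<dots> = C k * P"
        unfolding CN eq
        using E P unitriangular_carrier[OF U] by (intro assoc_mult_mat[symmetric]) auto
      finally have "reduces (Suc (Suc k)) fwd d M (C(Suc k := D * V))
           (\<lambda>i j. if i = Suc k \<or> j = Suc k then P else N i j)"
        using False P DV by (intro reduces_extend[OF CN(1)]) auto
      moreover have "(C(Suc k := D * V)) (Suc k) = D * V" by simp
      ultimately show ?thesis by blast
    qed
    thus ?thesis using D by blast
  qed
qed

lemma reduces_exists:
  assumes "quiver_rep n fwd d M"
  shows "\<exists>C N. reduces n fwd d M C N"
proof (cases n)
  case 0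
  thus ?thesis by (auto simp: reduces_def arrow_def)
next
  case (Suc k)
  thus ?thesis using reduces_flexible assms unitriangular_one by metis
qed

section \<open>Matrices indexed by the entries of a list\<close>

text \<open>
  Companion matrices, block-diagonal matrices and direct sums of intervals all have their rows
  and columns labelled by basis vectors. Naming the entries by labels instead of positions
  turns the permutation \<open>P\<close> of a barcode form into a reordering of the list of labels.
\<close>

definition list_mat :: "'b list \<Rightarrow> ('b \<Rightarrow> 'b \<Rightarrow> 'a) \<Rightarrow> 'a mat" where
  "list_mat xs F = mat (length xs) (length xs) (\<lambda>(r, c). F (xs ! r) (xs ! c))"

lemma list_mat_carrier: "list_mat xs F \<in> carrier_mat (length xs) (length xs)"
  by (simp add: list_mat_def)

lemma list_mat_cong:
  assumes "\<And>x y. x \<in> set xs \<Longrightarrow> y \<in> set xs \<Longrightarrow> F x y = G x y"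
  shows "list_mat xs F = list_mat xs G"
  unfolding list_mat_def using assms by (intro cong_mat) auto

lemma list_mat_one:
  assumes "distinct xs"
  shows "list_mat xs (\<lambda>x y. if x = y then 1 else 0) = 1\<^sub>m (length xs)"
  unfolding list_mat_def using assms by (intro eq_matI) (auto simp: nth_eq_iff_index_eq)

lemma list_mat_map: "list_mat (map g xs) F = list_mat xs (\<lambda>x y. F (g x) (g y))"
  unfolding list_mat_def by (intro eq_matI) auto

lemma list_mat_mult:
  fixes F G :: "'b \<Rightarrow> 'b \<Rightarrow> 'a :: semiring_0"
  assumes "distinct xs"
  shows "list_mat xs F * list_mat xs G = list_mat xs (\<lambda>x y. \<Sum>z\<in>set xs. F x z * G z y)"
proof (rule eq_matI)
  have bij: "bij_betw ((!) xs) {..<length xs} (set xs)"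
    using assms by (rule bij_betw_nth) auto
  fix r c
  assume "r < dim_row (list_mat xs (\<lambda>x y. \<Sum>z\<in>set xs. F x z * G z y))"
    "c < dim_col (list_mat xs (\<lambda>x y. \<Sum>z\<in>set xs. F x z * G z y))"
  thus "(list_mat xs F * list_mat xs G) $$ (r, c) =
        list_mat xs (\<lambda>x y. \<Sum>z\<in>set xs. F x z * G z y) $$ (r, c)"
    unfolding list_mat_def
    by (simp add: scalar_prod_def atLeast0LessThan sum.reindex_bij_betw[OF bij, symmetric])
qed (simp_all add: list_mat_def)

lemma list_mat_append:
  assumes "\<And>x y. x \<in> set xs \<Longrightarrow> y \<in> set ys \<Longrightarrow> F x y = 0 \<and> F y x = 0"
  shows "list_mat (xs @ ys) F =
           four_block_mat (list_mat xs F) (0\<^sub>m (length xs) (length ys))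
             (0\<^sub>m (length ys) (length xs)) (list_mat ys F)"
  unfolding list_mat_def using assms by (intro eq_matI) (auto simp: nth_append)

lemma diag_block_list_mat:
  assumes "sorted_wrt (\<lambda>xs ys. \<forall>x\<in>set xs. \<forall>y\<in>set ys. F x y = 0 \<and> F y x = 0) xss"
  shows "diag_block_mat (map (\<lambda>xs. list_mat xs F) xss) = list_mat (concat xss) F"
  using assms
proof (induction xss)
  case Nil
  show ?case by (auto simp: list_mat_def)
next
  case (Cons xs xss)
  hence IH: "diag_block_mat (map (\<lambda>xs. list_mat xs F) xss) = list_mat (concat xss) F" by simp
  show ?case
    using Cons.prems unfolding concat.simps list.map diag_block_mat.simps IH Let_def
    by (subst list_mat_append) (auto simp: list_mat_def)
qed

lemma perm_mat_conjugate_list_mat: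
  fixes F :: "'b \<Rightarrow> 'b \<Rightarrow> 'a :: semiring_1"
  assumes \<pi>: "\<pi> permutes {..<length xs}"
  shows "perm_mat (length xs) \<pi> * list_mat (permute_list \<pi> xs) F * (perm_mat (length xs) \<pi>)\<^sup>T
           = list_mat xs F"
proof (rule eq_matI)
  let ?N = "length xs"
  let ?P = "perm_mat ?N \<pi> :: 'a mat" and ?T = "list_mat (permute_list \<pi> xs) F"
  define q where "q = inv_into UNIV \<pi>"
  have iff: "(r = \<pi> x) = (x = q r)" for r x
    using permutes_inv_eq[OF \<pi>] unfolding q_def by metis
  have q: "q r < ?N" if "r < ?N" for r
    using permutes_in_image[OF permutes_inv[OF \<pi>]] that unfolding q_def by simp
  have \<pi>q: "\<pi> (q r) = r" for r
    using permutes_inverses(1)[OF \<pi>] unfolding q_def .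
  fix r c assume "r < dim_row (list_mat xs F)" "c < dim_col (list_mat xs F)"
  hence r: "r < ?N" and c: "c < ?N" by (auto simp: list_mat_def)
  have P: "?P \<in> carrier_mat ?N ?N" by (simp add: perm_mat_def)
  have T: "?T \<in> carrier_mat ?N ?N" by (simp add: list_mat_def)
  have PT: "(?P * ?T) $$ (a, y) = ?T $$ (q a, y)" if a: "a < ?N" and y: "y < ?N" for a y
  proof -
    have "(?P * ?T) $$ (a, y) = (\<Sum>x<?N. ?P $$ (a, x) * ?T $$ (x, y))"
      using a y P T by (auto simp: scalar_prod_def atLeast0LessThan)
    also have "\<dots> = (\<Sum>x<?N. if x = q a then ?T $$ (x, y) else 0)"
      using a by (intro sum.cong) (auto simp: perm_mat_def iff)
    finally have "(?P * ?T) $$ (a, y) = (\<Sum>x<?N. if x = q a then ?T $$ (x, y) else 0)" .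
    thus ?thesis using q[OF a] by simp
  qed
  have "(A * ?P\<^sup>T) $$ (r, c) = (\<Sum>y<?N. A $$ (r, y) * ?P $$ (c, y))"
    if "A \<in> carrier_mat ?N ?N" for A
    using that r c P by (auto simp: scalar_prod_def atLeast0LessThan)
  hence "(?P * ?T * ?P\<^sup>T) $$ (r, c) = (\<Sum>y<?N. (?P * ?T) $$ (r, y) * ?P $$ (c, y))"
    using mult_carrier_mat[OF P T] by blast
  also have "\<dots> = (\<Sum>y<?N. if y = q c then ?T $$ (q r, y) else 0)"
  proof (rule sum.cong)
    fix y assume "y \<in> {..<?N}"
    moreover from this have "?P $$ (c, y) = (if y = q c then 1 else 0)"
      using c by (simp add: perm_mat_def iff)
    ultimately show "(?P * ?T) $$ (r, y) * ?P $$ (c, y) = (if y = q c then ?T $$ (q r, y) else 0)"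
      using PT[OF r] by simp
  qed simp
  also have "\<dots> = ?T $$ (q r, q c)"
    using q[OF c] by simp
  also have "\<dots> = list_mat xs F $$ (r, c)"
    using r c q by (simp add: list_mat_def permute_list_nth[OF \<pi>] \<pi>q)
  finally show "(?P * ?T * ?P\<^sup>T) $$ (r, c) = list_mat xs F $$ (r, c)" .
qed (simp_all add: perm_mat_def list_mat_def)

section \<open>Companion matrices under block-diagonal base change\<close>

lemma set_basis_list: "set (basis_list n d) = Sigma {..<n} (\<lambda>i. {..<d i})"
  by (auto simp: basis_list_def)

lemma distinct_basis_list: "distinct (basis_list n d)"
  by (induction n) (auto simp: basis_list_def distinct_map inj_on_def)

lemma sorted_basis_list: "sorted_wrt (\<lambda>x y. fst x \<le> fst y) (basis_list n d)"
proof (induction n)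
  case (Suc n)
  have "sorted_wrt (\<lambda>x y. fst x \<le> fst y) (map (Pair n) [0..<d n])"
    by (simp add: sorted_wrt_map)
  with Suc show ?case
    by (auto simp: basis_list_def sorted_wrt_append)
qed (simp add: basis_list_def)

lemma sum_basis_list:
  "(\<Sum>z\<in>set (basis_list n d). f z) = (\<Sum>i<n. \<Sum>q<d i. f (i, q))"
  unfolding set_basis_list by (subst sum.Sigma) (auto intro!: sum.cong)

definition companion_entry ::
  "nat \<Rightarrow> (nat \<Rightarrow> bool) \<Rightarrow> (nat \<Rightarrow> nat \<Rightarrow> 'a :: zero mat) \<Rightarrow> nat \<times> nat \<Rightarrow> nat \<times> nat \<Rightarrow> 'a" where
  "companion_entry n fwd M = (\<lambda>(j, p) (i, q). if arrow n fwd i j then M i j $$ (p, q) else 0)"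

lemma companion_mat_eq_list_mat:
  "companion_mat n fwd d M = list_mat (basis_list n d) (companion_entry n fwd M)"
  unfolding companion_mat_def list_mat_def length_basis_list
  by (intro eq_matI) (auto simp: companion_entry_def split: prod.split)

definition diag_entry :: "(nat \<Rightarrow> 'a :: zero mat) \<Rightarrow> nat \<times> nat \<Rightarrow> nat \<times> nat \<Rightarrow> 'a" where
  "diag_entry C = (\<lambda>(j, p) (i, q). if i = j then C i $$ (p, q) else 0)"

lemma diag_block_mat_eq_list_mat:
  assumes "\<And>i. i < n \<Longrightarrow> C i \<in> carrier_mat (d i) (d i)"
  shows "diag_block_mat (map C [0..<n]) = list_mat (basis_list n d) (diag_entry C)"
proof -
  have "map C [0..<n] =
        map (\<lambda>xs. list_mat xs (diag_entry C)) (map (\<lambda>i. map (Pair i) [0..<d i]) [0..<n])"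
    using carrier_matD[OF assms] by (auto simp: list_mat_def diag_entry_def intro!: eq_matI)
  also have "diag_block_mat \<dots> = list_mat (basis_list n d) (diag_entry C)"
    unfolding basis_list_def
  proof (rule diag_block_list_mat)
    show "sorted_wrt (\<lambda>xs ys. \<forall>x\<in>set xs. \<forall>y\<in>set ys. diag_entry C x y = 0 \<and> diag_entry C y x = 0)
            (map (\<lambda>i. map (Pair i) [0..<d i]) [0..<n])"
      unfolding sorted_wrt_map
      by (rule sorted_wrt_mono_rel[OF _ sorted_wrt_upt])
        (auto simp: diag_entry_def)
  qed
  finally show ?thesis .
qed

lemma sum_diag_entry_left:
  fixes C :: "nat \<Rightarrow> 'a :: semiring_0 mat"
  assumes "j < n"
  shows "(\<Sum>z\<in>set (basis_list n d). diag_entry C (j, p) z * F z) =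
           (\<Sum>s<d j. C j $$ (p, s) * F (j, s))"
proof -
  have "(\<Sum>z\<in>set (basis_list n d). diag_entry C (j, p) z * F z) =
        (\<Sum>i<n. if i = j then \<Sum>s<d j. C j $$ (p, s) * F (j, s) else 0)"
    unfolding sum_basis_list by (intro sum.cong) (auto simp: diag_entry_def)
  thus ?thesis using assms by simp
qed

lemma sum_diag_entry_right:
  fixes C :: "nat \<Rightarrow> 'a :: semiring_0 mat"
  assumes "i < n"
  shows "(\<Sum>z\<in>set (basis_list n d). F z * diag_entry C z (i, q)) =
           (\<Sum>s<d i. F (i, s) * C i $$ (s, q))"
proof -
  have "(\<Sum>z\<in>set (basis_list n d). F z * diag_entry C z (i, q)) =
        (\<Sum>j<n. if j = i then \<Sum>s<d i. F (i, s) * C i $$ (s, q) else 0)"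
    unfolding sum_basis_list by (intro sum.cong) (auto simp: diag_entry_def)
  thus ?thesis using assms by simp
qed

lemma mult_diag_block_one:
  fixes C C' :: "nat \<Rightarrow> 'a :: semiring_1 mat"
  assumes C: "\<And>i. i < n \<Longrightarrow> C i \<in> carrier_mat (d i) (d i)"
    and C': "\<And>i. i < n \<Longrightarrow> C' i \<in> carrier_mat (d i) (d i)"
    and inv: "\<And>i. i < n \<Longrightarrow> C i * C' i = 1\<^sub>m (d i)"
  shows "diag_block_mat (map C [0..<n]) * diag_block_mat (map C' [0..<n]) = 1\<^sub>m (total_dim n d)"
proof -
  have entry: "(\<Sum>s<d i. C i $$ (p, s) * C' i $$ (s, q)) = (if p = q then 1 else 0)"
    if "i < n" "p < d i" "q < d i" for i p q
  proof -
    have "(\<Sum>s<d i. C i $$ (p, s) * C' i $$ (s, q)) = (C i * C' i) $$ (p, q)"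
      using that C[of i] C'[of i] by (auto simp: scalar_prod_def atLeast0LessThan)
    thus ?thesis using that inv by simp
  qed
  have "diag_block_mat (map C [0..<n]) * diag_block_mat (map C' [0..<n]) =
        list_mat (basis_list n d)
          (\<lambda>x y. \<Sum>z\<in>set (basis_list n d). diag_entry C x z * diag_entry C' z y)"
    by (simp add: diag_block_mat_eq_list_mat[of n C d, OF C]
        diag_block_mat_eq_list_mat[of n C' d, OF C'] list_mat_mult distinct_basis_list)
  also have "\<dots> = list_mat (basis_list n d) (\<lambda>x y. if x = y then 1 else 0)"
  proof (rule list_mat_cong, clarify)
    fix j p i q assume "(j, p) \<in> set (basis_list n d)" "(i, q) \<in> set (basis_list n d)"
    hence jpiq: "j < n" "p < d j" "i < n" "q < d i" by (auto simp: set_basis_list)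
    show "(\<Sum>z\<in>set (basis_list n d). diag_entry C (j, p) z * diag_entry C' z (i, q)) =
          (if (j, p) = (i, q) then 1 else 0)"
      unfolding sum_diag_entry_left[OF jpiq(1)] using jpiq entry
      by (cases "i = j") (auto simp: diag_entry_def)
  qed
  finally show ?thesis
    by (simp add: list_mat_one distinct_basis_list length_basis_list)
qed

lemma companion_mat_mult_diag_block:
  fixes M N :: "nat \<Rightarrow> nat \<Rightarrow> 'a :: semiring_1 mat"
  assumes M: "quiver_rep n fwd d M" and N: "quiver_rep n fwd d N"
    and C: "\<And>i. i < n \<Longrightarrow> C i \<in> carrier_mat (d i) (d i)"
    and eq: "\<And>i j. arrow n fwd i j \<Longrightarrow> M i j * C i = C j * N i j"
  shows "companion_mat n fwd d M * diag_block_mat (map C [0..<n]) =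
           diag_block_mat (map C [0..<n]) * companion_mat n fwd d N"
proof -
  have entry: "(\<Sum>s<d i. M i j $$ (p, s) * C i $$ (s, q)) = (\<Sum>s<d j. C j $$ (p, s) * N i j $$ (s, q))"
    if a: "arrow n fwd i j" and pq: "p < d j" "q < d i" for i j p q
  proof -
    have ij: "i < n" "j < n" using a by (auto simp: arrow_def)
    have MN: "M i j \<in> carrier_mat (d j) (d i)" "N i j \<in> carrier_mat (d j) (d i)"
      using M N a by (auto simp: quiver_rep_def)
    have "(\<Sum>s<d i. M i j $$ (p, s) * C i $$ (s, q)) = (M i j * C i) $$ (p, q)"
      using pq MN C[OF ij(1)] by (auto simp: scalar_prod_def atLeast0LessThan)
    also have "\<dots> = (C j * N i j) $$ (p, q)" by (simp add: eq[OF a])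
    also have "\<dots> = (\<Sum>s<d j. C j $$ (p, s) * N i j $$ (s, q))"
      using pq MN C[OF ij(2)] by (auto simp: scalar_prod_def atLeast0LessThan)
    finally show ?thesis .
  qed
  have diag: "diag_block_mat (map C [0..<n]) = list_mat (basis_list n d) (diag_entry C)"
    by (rule diag_block_mat_eq_list_mat) (rule C)
  show ?thesis
    unfolding companion_mat_eq_list_mat diag list_mat_mult[OF distinct_basis_list]
  proof (rule list_mat_cong, clarify)
    fix j p i q assume "(j, p) \<in> set (basis_list n d)" "(i, q) \<in> set (basis_list n d)"
    hence jpiq: "j < n" "p < d j" "i < n" "q < d i" by (auto simp: set_basis_list)
    show "(\<Sum>z\<in>set (basis_list n d). companion_entry n fwd M (j, p) z * diag_entry C z (i, q)) =
          (\<Sum>z\<in>set (basis_list n d). diag_entry C (j, p) z * companion_entry n fwd N z (i, q))"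
      unfolding sum_diag_entry_left[OF jpiq(1)] sum_diag_entry_right[OF jpiq(3)]
      using jpiq entry[of i j p q] by (cases "arrow n fwd i j") (simp_all add: companion_entry_def)
  qed
qed

lemma reduces_similar:
  assumes M: "quiver_rep n fwd d M" and S: "reduces n fwd d M C N"
  shows "\<exists>B_inv. similar_mat_wit (companion_mat n fwd d M) (companion_mat n fwd d N)
           (diag_block_mat (map C [0..<n])) B_inv"
proof -
  have C: "C i \<in> carrier_mat (d i) (d i)" if "i < n" for i
    using reducesD(1)[OF S that] .
  have "\<forall>i. \<exists>B. i < n \<longrightarrow> B \<in> carrier_mat (d i) (d i) \<and> C i * B = 1\<^sub>m (d i) \<and> B * C i = 1\<^sub>m (d i)"
    using det_nonzero_obtain_inverse reducesD(1,2)[OF S] by metis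
  then obtain C' where C': "\<And>i. i < n \<Longrightarrow> C' i \<in> carrier_mat (d i) (d i)"
    "\<And>i. i < n \<Longrightarrow> C i * C' i = 1\<^sub>m (d i)" "\<And>i. i < n \<Longrightarrow> C' i * C i = 1\<^sub>m (d i)"
    by metis
  let ?K = "total_dim n d"
  let ?A = "companion_mat n fwd d M" and ?L = "companion_mat n fwd d N"
  let ?P = "diag_block_mat (map C [0..<n])" and ?Q = "diag_block_mat (map C' [0..<n])"
  have carr: "?A \<in> carrier_mat ?K ?K" "?L \<in> carrier_mat ?K ?K"
    "?P \<in> carrier_mat ?K ?K" "?Q \<in> carrier_mat ?K ?K"
    using diag_block_mat_eq_list_mat[of n C d, OF C] diag_block_mat_eq_list_mat[of n C' d, OF C'(1)]
    by (simp_all add: companion_mat_eq_list_mat list_mat_carrier length_basis_list[symmetric])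
  have PQ: "?P * ?Q = 1\<^sub>m ?K" and QP: "?Q * ?P = 1\<^sub>m ?K"
    using mult_diag_block_one C C' by blast+
  have "quiver_rep n fwd d N" using reducesD(3)[OF S] by (simp add: quiver_rep_def)
  hence "?A * ?P = ?P * ?L"
    using companion_mat_mult_diag_block[OF M _ C] reducesD(5)[OF S] by blast
  hence "?P * ?L * ?Q = ?A * ?P * ?Q" by simp
  also have "\<dots> = ?A * (?P * ?Q)"
    using carr by (intro assoc_mult_mat)
  finally have "?A = ?P * ?L * ?Q" using PQ carr by simp
  thus ?thesis
    using carr PQ QP by (intro exI[of _ ?Q] similar_mat_witI) auto
qed

section \<open>Chains of basis vectors\<close>

text \<open>
  A relation whose links are unique in both directions and never lead backwards in the list \<open>xs\<close>
  consists of disjoint paths. Inserting the elements in the order of \<open>xs\<close>, each new element has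
  no successor yet, so it either starts a path or is appended to the one that ends
  at its predecessor. The last conjunct makes the paths complete: no link leaves a chain.
\<close>

lemma chain_decomposition:
  assumes "distinct xs"
    and "sorted_wrt (\<lambda>x y. \<not> E y x) xs"
    and "\<And>x. x \<in> set xs \<Longrightarrow> \<not> E x x"
    and "\<And>x y z. \<lbrakk>x \<in> set xs; y \<in> set xs; z \<in> set xs; E x y; E x z\<rbrakk> \<Longrightarrow> y = z"
    and "\<And>x y z. \<lbrakk>x \<in> set xs; y \<in> set xs; z \<in> set xs; E x z; E y z\<rbrakk> \<Longrightarrow> x = y"
  shows "\<exists>Ls. mset (concat Ls) = mset xs \<and> [] \<notin> set Ls \<and> (\<forall>L\<in>set Ls. successively E L) \<and>
           (\<forall>L\<in>set Ls. \<forall>x\<in>set L. \<forall>y\<in>set xs. E x y \<longrightarrow> y \<in> set L)"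
  using assms
proof (induction xs rule: rev_induct)
  case Nil
  show ?case by (intro exI[of _ "[]"]) simp
next
  case (snoc z xs)
  have "\<exists>Ls. mset (concat Ls) = mset xs \<and> [] \<notin> set Ls \<and> (\<forall>L\<in>set Ls. successively E L) \<and>
           (\<forall>L\<in>set Ls. \<forall>x\<in>set L. \<forall>y\<in>set xs. E x y \<longrightarrow> y \<in> set L)"
  proof (rule snoc.IH)
    show "distinct xs" "sorted_wrt (\<lambda>x y. \<not> E y x) xs"
      using snoc.prems(1,2) by (auto simp: sorted_wrt_append)
    show "\<not> E x x" if "x \<in> set xs" for x
      using snoc.prems(3) that by simp
    show "y = v" if "x \<in> set xs" "y \<in> set xs" "v \<in> set xs" "E x y" "E x v" for x y v
      using snoc.prems(4)[of x y v] that by simp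
    show "x = y" if "x \<in> set xs" "y \<in> set xs" "v \<in> set xs" "E x v" "E y v" for x y v
      using snoc.prems(5)[of x y v] that by simp
  qed
  then obtain Ls where Ls: "mset (concat Ls) = mset xs" "[] \<notin> set Ls"
    "\<And>L. L \<in> set Ls \<Longrightarrow> successively E L"
    "\<And>L x y. \<lbrakk>L \<in> set Ls; x \<in> set L; y \<in> set xs; E x y\<rbrakk> \<Longrightarrow> y \<in> set L"
    by blast
  have set_xs: "set xs = (\<Union>L\<in>set Ls. set L)"
    using mset_eq_setD[OF Ls(1)] by simp
  have dist: "distinct (concat Ls)"
    using Ls(1) snoc.prems(1) by (metis distinct_append mset_eq_imp_distinct_iff)
  have noz: "\<not> E z y" if "y \<in> set xs \<or> y = z" for y
    using snoc.prems(2,3) that by (auto simp: sorted_wrt_append)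
  show ?case
  proof (cases "\<exists>x\<in>set xs. E x z")
    case False
    have "mset (concat (Ls @ [[z]])) = mset (xs @ [z])" using Ls(1) by simp
    moreover have "[] \<notin> set (Ls @ [[z]])" using Ls(2) by simp
    moreover have "successively E K" if "K \<in> set (Ls @ [[z]])" for K
      using that Ls(3) by auto
    moreover have "y \<in> set K"
      if "K \<in> set (Ls @ [[z]])" "v \<in> set K" "y \<in> set (xs @ [z])" "E v y" for K v y
    proof (cases "K = [z]")
      case True
      thus ?thesis using that noz by auto
    next
      case False
      hence K: "K \<in> set Ls" using that by auto
      hence "v \<in> set xs" using that set_xs by blast
      hence "y \<noteq> z" using that \<open>\<not> (\<exists>x\<in>set xs. E x z)\<close> by blast
      thus ?thesis using that Ls(4)[OF K] by simp
    qed
    ultimately show ?thesis by (intro exI[of _ "Ls @ [[z]]"]) blast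
  next
    case True
    then obtain x where x: "x \<in> set xs" "E x z" by blast
    then obtain L where L: "L \<in> set Ls" "x \<in> set L" using set_xs by blast
    then obtain As Bs where AB: "Ls = As @ L # Bs" by (meson split_list)
    have "z \<notin> set xs" using snoc.prems(1) by simp
    have "L \<noteq> []" using L by auto
    \<comment> \<open>The predecessor of \<open>z\<close> has no other successor, so it ends its chain.\<close>
    have last: "last L = x"
    proof (rule ccontr)
      assume "last L \<noteq> x"
      from L(2) obtain i where i: "i < length L" "L ! i = x" by (auto simp: in_set_conv_nth)
      hence "i \<noteq> length L - 1"
        using \<open>last L \<noteq> x\<close> \<open>L \<noteq> []\<close> by (metis last_conv_nth)
      hence "Suc i < length L" using i by simp
      hence "E x (L ! Suc i)" "L ! Suc i \<in> set L"
        using successively_nth[OF Ls(3)[OF L(1)]] i by auto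
      moreover from this have "L ! Suc i \<in> set xs" using L set_xs by blast
      ultimately show False
        using snoc.prems(4)[of x z "L ! Suc i"] x \<open>z \<notin> set xs\<close> by auto
    qed
    have nox: "y = x" if "y \<in> set xs" "E y z" for y
      using snoc.prems(5)[of y x z] that x by auto
    have noL: "x \<notin> set K" if "K \<in> set As \<union> set Bs" for K
      using dist L that unfolding AB by auto
    let ?Ls = "As @ (L @ [z]) # Bs"
    have "mset (concat ?Ls) = mset (xs @ [z])"
      using Ls(1) by (simp add: AB)
    moreover have "[] \<notin> set ?Ls" using Ls(2) by (auto simp: AB)
    moreover have "successively E K" if "K \<in> set ?Ls" for K
      using that Ls(3) x last \<open>L \<noteq> []\<close> by (auto simp: AB successively_append_iff)
    moreover have "y \<in> set K" if "K \<in> set ?Ls" "v \<in> set K" "y \<in> set (xs @ [z])" "E v y" for K v y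
    proof (cases "K = L @ [z]")
      case True
      thus ?thesis using that noz Ls(4)[OF L(1)] by (cases "v = z") auto
    next
      case False
      hence K: "K \<in> set As \<union> set Bs" "K \<in> set Ls" using that by (auto simp: AB)
      hence "v \<in> set xs" using that set_xs by blast
      moreover have "v \<noteq> x" using noL K that by blast
      ultimately have "y \<noteq> z" using nox that by blast
      thus ?thesis using that Ls(4)[OF K(2)] by simp
    qed
    ultimately show ?thesis by (intro exI[of _ ?Ls]) blast
  qed
qed

lemma nth_chain_of_consecutive:
  assumes "successively (\<lambda>x y. f y = Suc (f x)) L" "k < length L"
  shows "f (L ! k) = f (hd L) + k"
  using assms(2)
proof (induction k)
  case 0
  thus ?case by (simp add: hd_conv_nth)
next
  case (Suc k)
  thus ?case using successively_nth[OF assms(1) Suc.prems] by simp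
qed

lemma map_chain_of_consecutive:
  fixes f :: "'b \<Rightarrow> nat"
  assumes "successively (\<lambda>x y. f y = Suc (f x)) L" "L \<noteq> []"
  shows "map f L = [f (hd L)..<Suc (f (last L))]"
proof (rule nth_equalityI)
  have "f (last L) = f (hd L) + (length L - 1)"
    using nth_chain_of_consecutive[OF assms(1), of "length L - 1"] assms(2) by (simp add: last_conv_nth)
  thus len: "length (map f L) = length [f (hd L)..<Suc (f (last L))]"
    using assms(2) by (cases L) auto
  fix k assume "k < length (map f L)"
  thus "map f L ! k = [f (hd L)..<Suc (f (last L))] ! k"
    using nth_chain_of_consecutive[OF assms(1), of k] len by (simp del: upt_Suc)
qed

lemma sorted_wrt_disjoint_if_distinct_concat:
  "distinct (concat xss) \<Longrightarrow> sorted_wrt (\<lambda>xs ys. set xs \<inter> set ys = {}) xss"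
  by (induction xss) auto

section \<open>Barcode form of a reduced representation\<close>

lemma basis_list_interval:
  assumes "b \<le> e" "e < n"
  shows "basis_list n (interval_dim b e) = map (\<lambda>i. (i, 0)) [b..<Suc e]"
proof -
  let ?f = "\<lambda>i. map (Pair i) [0..<interval_dim b e i]"
  have split: "[0..<n] = [0..<b] @ [b..<Suc e] @ [Suc e..<n]"
    using upt_add_eq_append[of 0 b "n - b"] upt_add_eq_append[of b "Suc e" "n - Suc e"] assms
    by simp
  have "concat (map ?f [0..<b]) = []" "concat (map ?f [Suc e..<n]) = []"
    by (auto simp: interval_dim_def)
  moreover have "map ?f [b..<Suc e] = map (\<lambda>i. [(i, 0)]) [b..<Suc e]"
    by (intro map_cong) (auto simp: interval_dim_def)
  ultimately show ?thesis
    unfolding basis_list_def split by (simp del: upt_Suc concat_eq_Nil_conv map_eq_conv)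
qed

text \<open>
  The interval has one basis vector at each of its vertices, which serves as its label.
\<close>

lemma companion_mat_interval:
  assumes "b \<le> e" "e < n"
  shows "companion_mat n fwd (interval_dim b e) (interval_map b e) =
           list_mat [b..<Suc e] (\<lambda>j i. if arrow n fwd i j then 1 else 0)"
  unfolding companion_mat_eq_list_mat basis_list_interval[OF assms] list_mat_map
  by (rule list_mat_cong) (auto simp: companion_entry_def interval_map_def)

text \<open>
  Link two basis vectors at neighbouring vertices if the arrow between them maps one to the
  other, regardless of its direction. As every arrow is a partial permutation, links are
  unique to the left and to the right, and the chains are the bars: a chain visits consecutive
  vertices, the companion matrix restricted to it is that of an interval, and entries between
  different chains vanish. Listing the basis chain by chain gives the permutation.
\<close>

lemma barcode_form_companion_mat:
  fixes N :: "nat \<Rightarrow> nat \<Rightarrow> 'a :: semiring_1 mat"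
  assumes N: "quiver_rep n fwd d N"
    and pp: "\<And>i j. arrow n fwd i j \<Longrightarrow> partial_perm (N i j)"
  shows "barcode_form n fwd d (companion_mat n fwd d N)"
proof -
  define xs where "xs = basis_list n d"
  define K where "K = companion_entry n fwd N"
  define E where "E x y \<longleftrightarrow> fst y = Suc (fst x) \<and> (K y x \<noteq> 0 \<or> K x y \<noteq> 0)"
    for x y :: "nat \<times> nat"
  have arr: "arrow n fwd (fst y) (fst x)" if "K x y \<noteq> 0" for x y
    using that by (auto simp: K_def companion_entry_def split: prod.splits if_splits)
  have adj: "E x y \<or> E y x" if "K x y \<noteq> 0" for x y
    using arr[OF that] that by (auto simp: E_def arrow_def)
  \<comment> \<open>Each edge carries one arrow, so a link stems from exactly one of the two entries.\<close>
  have asym: "\<not> arrow n fwd j i" if "arrow n fwd i j" for i j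
    using that by (auto simp: arrow_def)
  have K: "K x y = N (fst y) (fst x) $$ (snd x, snd y)" if "arrow n fwd (fst y) (fst x)" for x y
    using that by (auto simp: K_def companion_entry_def split: prod.splits)
  have dims: "dim_row (N i j) = d j" "dim_col (N i j) = d i" if "arrow n fwd i j" for i j
    using N that by (auto simp: quiver_rep_def)
  have mem: "snd x < d (fst x)" if "x \<in> set xs" for x
    using that by (auto simp: xs_def set_basis_list)
  have K01: "K x y = 1" if "K x y \<noteq> 0" "x \<in> set xs" "y \<in> set xs" for x y
    using pp[OF arr[OF that(1)]] dims[OF arr[OF that(1)]] K[OF arr[OF that(1)]] mem[OF that(2)] mem[OF that(3)] that
    by (auto simp: partial_perm_def)
  have row: "y = z" if "K x y \<noteq> 0" "K x z \<noteq> 0" "fst y = fst z"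
      "x \<in> set xs" "y \<in> set xs" "z \<in> set xs" for x y z
    using pp[OF arr[OF that(1)]] dims[OF arr[OF that(1)]]
      K[OF arr[OF that(1)]] K[OF arr[OF that(2)]] mem[OF that(4)] mem[OF that(5)] mem[OF that(6)] that
    by (auto simp: partial_perm_def prod_eq_iff)
  have col: "y = z" if "K y x \<noteq> 0" "K z x \<noteq> 0" "fst y = fst z"
      "x \<in> set xs" "y \<in> set xs" "z \<in> set xs" for x y z
    using pp[OF arr[OF that(1)]] dims[OF arr[OF that(1)]]
      K[OF arr[OF that(1)]] K[OF arr[OF that(2)]] mem[OF that(4)] mem[OF that(5)] mem[OF that(6)] that
    by (auto simp: partial_perm_def prod_eq_iff)
  have "\<exists>Ls. mset (concat Ls) = mset xs \<and> [] \<notin> set Ls \<and> (\<forall>L\<in>set Ls. successively E L) \<and>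
           (\<forall>L\<in>set Ls. \<forall>x\<in>set L. \<forall>y\<in>set xs. E x y \<longrightarrow> y \<in> set L)"
  proof (rule chain_decomposition)
    show "distinct xs" by (simp add: xs_def distinct_basis_list)
    show "sorted_wrt (\<lambda>x y. \<not> E y x) xs"
      unfolding xs_def
      by (rule sorted_wrt_mono_rel[OF _ sorted_basis_list]) (auto simp: E_def)
    show "\<not> E x x" for x by (simp add: E_def)
    show "y = z" if "x \<in> set xs" "y \<in> set xs" "z \<in> set xs" "E x y" "E x z" for x y z
      using that row[of x y z] col[of y x z] arr[of x y] arr[of x z] arr[of y x] arr[of z x]
        asym[of "fst x" "fst y"] unfolding E_def by metis
    show "x = y" if "x \<in> set xs" "y \<in> set xs" "z \<in> set xs" "E x z" "E y z" for x y z
      using that row[of z x y] col[of x z y] arr[of x z] arr[of y z] arr[of z x] arr[of z y]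
        asym[of "fst x" "fst z"] unfolding E_def by (metis nat.inject)
  qed
  then obtain Ls where Ls: "mset (concat Ls) = mset xs" "[] \<notin> set Ls"
    "\<And>L. L \<in> set Ls \<Longrightarrow> successively E L"
    "\<And>L x y. \<lbrakk>L \<in> set Ls; x \<in> set L; y \<in> set xs; E x y\<rbrakk> \<Longrightarrow> y \<in> set L"
    by blast
  obtain \<pi> where \<pi>: "\<pi> permutes {..<length xs}" "permute_list \<pi> xs = concat Ls"
    using mset_eq_permutation[OF Ls(1)] by blast
  have len: "length xs = total_dim n d" by (simp add: xs_def length_basis_list)
  have sub: "x \<in> set xs" if "L \<in> set Ls" "x \<in> set L" for L x
    using mset_eq_setD[OF Ls(1)] that by auto
  have dist: "distinct (concat Ls)"
    using Ls(1) distinct_basis_list unfolding xs_def by (metis mset_eq_imp_distinct_iff)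
  have cons: "successively (\<lambda>x y. fst y = Suc (fst x)) L" if "L \<in> set Ls" for L
    using Ls(3)[OF that] by (rule successively_mono) (simp add: E_def)
  define bars where "bars = map (\<lambda>L. (fst (hd L), fst (last L))) Ls"
  have fst_L: "map fst L = [fst (hd L)..<Suc (fst (last L))]" if "L \<in> set Ls" for L
    using map_chain_of_consecutive[OF cons[OF that]] Ls(2) that by metis
  have bounds: "fst (hd L) \<le> fst (last L)" "fst (last L) < n" if L: "L \<in> set Ls" for L
  proof -
    have "L \<noteq> []" using Ls(2) L by metis
    have "[fst (hd L)..<Suc (fst (last L))] \<noteq> []"
      using \<open>L \<noteq> []\<close> fst_L[OF L] by (metis map_is_Nil_conv)
    thus "fst (hd L) \<le> fst (last L)" by (simp split: if_splits)
    have "last L \<in> set xs" using sub[OF L] \<open>L \<noteq> []\<close> by simp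
    thus "fst (last L) < n" by (auto simp: xs_def set_basis_list)
  qed
  have vertices: "barcode_vertices n bars = map fst (concat Ls)"
    unfolding barcode_vertices_def bars_def map_map map_concat
    using bounds fst_L by (intro arg_cong[of _ _ concat] map_cong) (auto simp: basis_list_interval o_def)
  have block: "companion_mat n fwd (interval_dim (fst (hd L)) (fst (last L)))
                 (interval_map (fst (hd L)) (fst (last L))) = list_mat L K" if L: "L \<in> set Ls" for L
  proof -
    have "list_mat L (\<lambda>x y. if arrow n fwd (fst y) (fst x) then 1 else 0) = list_mat L K"
    proof (rule list_mat_cong)
      fix x y assume x: "x \<in> set L" and y: "y \<in> set L"
      have "K x y = 1" if a: "arrow n fwd (fst y) (fst x)"
      proof -
        obtain k l where kl: "k < length L" "x = L ! k" "l < length L" "y = L ! l"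
          using x y by (metis in_set_conv_nth)
        \<comment> \<open>A chain meets each vertex once, so an arrow inside it joins successive elements.\<close>
        have "k = Suc l \<or> l = Suc k"
          using a kl nth_chain_of_consecutive[OF cons[OF L]] by (auto simp: arrow_def)
        hence "E y x \<or> E x y"
          using kl successively_nth[OF Ls(3)[OF L]] by auto
        hence "K x y \<noteq> 0"
          using a asym arr by (metis E_def)
        thus ?thesis using K01 sub L x y by blast
      qed
      thus "(if arrow n fwd (fst y) (fst x) then 1 else 0) = K x y"
        using arr[of x y] by auto
    qed
    thus ?thesis
      unfolding companion_mat_interval[OF bounds[OF L]] fst_L[OF L, symmetric] list_mat_map .
  qed
  have "barcode_sum n fwd bars = diag_block_mat (map (\<lambda>L. list_mat L K) Ls)"
    unfolding barcode_sum_def bars_def map_map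
    by (intro arg_cong[of _ _ diag_block_mat] map_cong) (auto simp: block)
  also have "\<dots> = list_mat (permute_list \<pi> xs) K"
    unfolding \<pi>(2)
  proof (rule diag_block_list_mat)
    have "K x y = 0 \<and> K y x = 0"
      if "L \<in> set Ls" "L' \<in> set Ls" "set L \<inter> set L' = {}" "x \<in> set L" "y \<in> set L'" for L L' x y
    proof -
      have "\<not> E x y" "\<not> E y x"
        using that Ls(4)[of L x y] Ls(4)[of L' y x] sub[of L x] sub[of L' y] by auto
      thus ?thesis using adj by blast
    qed
    thus "sorted_wrt (\<lambda>L L'. \<forall>x\<in>set L. \<forall>y\<in>set L'. K x y = 0 \<and> K y x = 0) Ls"
      by (intro sorted_wrt_mono_rel[OF _ sorted_wrt_disjoint_if_distinct_concat[OF dist]]) blast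
  qed
  finally have sum: "barcode_sum n fwd bars = list_mat (permute_list \<pi> xs) K" .
  have \<Lambda>: "companion_mat n fwd d N = list_mat xs K"
    by (simp add: companion_mat_eq_list_mat xs_def K_def)
  have "\<forall>(b, e)\<in>set bars. b \<le> e \<and> e < n"
    using bounds by (auto simp: bars_def)
  moreover have "length (barcode_vertices n bars) = total_dim n d"
    unfolding vertices \<pi>(2)[symmetric] by (simp add: len)
  moreover have "\<pi> permutes {..<total_dim n d}"
    using \<pi>(1) by (simp add: len)
  moreover have "\<forall>c < total_dim n d. fst (basis_list n d ! \<pi> c) = barcode_vertices n bars ! c"
    unfolding vertices \<pi>(2)[symmetric] xs_def[symmetric]
    using \<pi>(1) by (simp add: len[symmetric] permute_list_nth)
  moreover have "companion_mat n fwd d N = perm_mat (total_dim n d) \<pi> * barcode_sum n fwd bars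
              * (perm_mat (total_dim n d) \<pi>)\<^sup>T"
    unfolding \<Lambda> sum len[symmetric] using perm_mat_conjugate_list_mat[OF \<pi>(1)] by metis
  ultimately show ?thesis
    unfolding barcode_form_def using N by blast
qed

section \<open>Existence of barcode forms\<close>

theorem proposition17:
  fixes n :: nat
    and fwd :: "nat \<Rightarrow> bool"
    and d :: "nat \<Rightarrow> nat"
    and M :: "nat \<Rightarrow> nat \<Rightarrow> 'a :: field mat"
  assumes "quiver_rep n fwd d M"
  shows "\<exists>C B B_inv \<Lambda>.
           (\<forall>i<n. C i \<in> carrier_mat (d i) (d i)) \<and>
           B = diag_block_mat (map C [0..<n]) \<and>
           similar_mat_wit (companion_mat n fwd d M) \<Lambda> B B_inv \<and>
           barcode_form n fwd d \<Lambda>"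
proof -
  obtain C N where S: "reduces n fwd d M C N"
    using reduces_exists[OF assms] by blast
  obtain B_inv where "similar_mat_wit (companion_mat n fwd d M) (companion_mat n fwd d N)
      (diag_block_mat (map C [0..<n])) B_inv"
    using reduces_similar[OF assms S] by blast
  moreover have "barcode_form n fwd d (companion_mat n fwd d N)"
    using reducesD(3,4)[OF S] by (intro barcode_form_companion_mat) (auto simp: quiver_rep_def)
  ultimately show ?thesis
    using reducesD(1)[OF S] by blast
qed

end
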